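(* Let $\Sigma_g$ be a closed oriented surface of genus $g\ge 1$. The fundamental group $\Gamma_g=\pi_1(\Sigma_g)$ of $\Sigma_g$ admits a transitive, faithful and amenable action, for all $g\ge1$.
   Context: The group $\Gamma_g$ has the presentation $\langle a_1,b_1,\dots,a_g,b_g\mid \prod_{i=1}^g[a_i,b_i]\rangle$. An action of a group $G$ on a set $X$ is amenable if there is a $G$-invariant mean on $X$, i.e. a map $\mu:\mathcal P(X)\to[0,1]$ with $\mu(X)=1$, $\mu(A\cup B)=\mu(A)+\mu(B)$ for all disjoint $A,B\subseteq X$, and $\mu(gA)=\mu(A)$ for all $g\in G$, $A\subseteq X$. *)

theory Defs
  imports Complex_Main "HOL-Algebra.Group_Action" "HOL-Algebra.Generated_Groups"
begin

section \<open>Free groups\<close>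

text \<open>A letter \<open>(s, e)\<close> stands for the generator \<open>s\<close> if \<open>e\<close> is \<open>True\<close> and for its inverse otherwise.\<close>

type_synonym 'a word = "('a \<times> bool) list"

fun inv_letter :: "'a \<times> bool \<Rightarrow> 'a \<times> bool" where
  "inv_letter (s, e) = (s, \<not> e)"

definition reduced_word :: "'a word \<Rightarrow> bool" where
  "reduced_word w \<longleftrightarrow> successively (\<lambda>x y. y \<noteq> inv_letter x) w"

text \<open>Left multiplication of a reduced word by one letter.\<close>

fun push_letter :: "'a \<times> bool \<Rightarrow> 'a word \<Rightarrow> 'a word" where
  "push_letter x [] = [x]"
| "push_letter x (y # w) = (if y = inv_letter x then w else x # y # w)"

definition free_group :: "'a set \<Rightarrow> 'a word monoid" where
  "free_group S =
     \<lparr>carrier = {w. set w \<subseteq> S \<times> UNIV \<and> reduced_word w},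
      mult = foldr push_letter,
      one = []\<rparr>"

lemma inv_letter_inv_letter [simp]: "inv_letter (inv_letter x) = x"
  by (cases x) auto

lemma inv_letter_in_iff [simp]: "inv_letter x \<in> S \<times> UNIV \<longleftrightarrow> x \<in> S \<times> UNIV"
  by (cases x) auto

lemma reduced_word_Nil [simp]: "reduced_word []"
  by (simp add: reduced_word_def)

lemma reduced_word_ConsD: "reduced_word (x # w) \<Longrightarrow> reduced_word w"
  by (cases w) (auto simp: reduced_word_def)

lemma reduced_push_letter: "reduced_word w \<Longrightarrow> reduced_word (push_letter x w)"
  by (cases w) (auto simp: reduced_word_def dest: reduced_word_ConsD[unfolded reduced_word_def])

lemma reduced_foldr_push_letter: "reduced_word v \<Longrightarrow> reduced_word (foldr push_letter w v)"
  by (induction w) (auto intro: reduced_push_letter)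

lemma push_letter_cancel:
  assumes "reduced_word w"
  shows "push_letter x (push_letter (inv_letter x) w) = w"
  using assms by (cases w rule: remdups_adj.cases) (auto simp: reduced_word_def)

lemma set_push_letter: "set (push_letter x w) \<subseteq> insert x (set w)"
  by (cases w) auto

lemma set_foldr_push_letter: "set (foldr push_letter w v) \<subseteq> set w \<union> set v"
  by (induction w) (use set_push_letter in fastforce)+

lemma foldr_push_letter_push_letter:
  assumes "reduced_word v"
  shows "foldr push_letter (push_letter x u) v = push_letter x (foldr push_letter u v)"
  by (cases u) (auto simp: push_letter_cancel reduced_foldr_push_letter assms)

lemma foldr_push_letter_assoc:
  assumes "reduced_word v"
  shows "foldr push_letter (foldr push_letter w u) v = foldr push_letter w (foldr push_letter u v)"
  by (induction w) (auto simp: foldr_push_letter_push_letter assms)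

lemma foldr_push_letter_inverse:
  "foldr push_letter (rev (map inv_letter w)) w = []"
  by (induction w) auto

lemma reduced_inverse:
  "reduced_word w \<Longrightarrow> reduced_word (rev (map inv_letter w))"
  unfolding reduced_word_def successively_rev successively_map
  by (erule successively_mono) (metis inv_letter_inv_letter)

lemma group_free_group: "group (free_group S)"
proof (rule groupI)
  fix w assume w: "w \<in> carrier (free_group S)"
  have "rev (map inv_letter w) \<in> carrier (free_group S)"
    using w by (force simp: free_group_def intro: reduced_inverse)
  then show "\<exists>v\<in>carrier (free_group S). v \<otimes>\<^bsub>free_group S\<^esub> w = \<one>\<^bsub>free_group S\<^esub>"
    by (intro bexI[of _ "rev (map inv_letter w)"])
       (simp_all add: free_group_def foldr_push_letter_inverse)
next
  fix v w assume "v \<in> carrier (free_group S)" "w \<in> carrier (free_group S)"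
  then show "v \<otimes>\<^bsub>free_group S\<^esub> w \<in> carrier (free_group S)"
    using set_foldr_push_letter[of v w]
    by (auto simp: free_group_def reduced_foldr_push_letter)
qed (auto simp: free_group_def foldr_push_letter_assoc)

section \<open>Group presentations\<close>

definition normal_closure :: "('a, 'b) monoid_scheme \<Rightarrow> 'a set \<Rightarrow> 'a set" where
  "normal_closure G R =
     generate G (\<Union>h\<in>carrier G. (\<lambda>r. h \<otimes>\<^bsub>G\<^esub> r \<otimes>\<^bsub>G\<^esub> inv\<^bsub>G\<^esub> h) ` R)"

text \<open>Relators are required to be given as reduced words, i.e. as elements of \<^term>\<open>free_group S\<close>.\<close>

definition presented_group :: "'a set \<Rightarrow> 'a word set \<Rightarrow> 'a word set monoid" where
  "presented_group S R = free_group S Mod normal_closure (free_group S) R"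

lemma (in group) normal_normal_closure:
  assumes "R \<subseteq> carrier G"
  shows "normal_closure G R \<lhd> G"
  unfolding normal_closure_def
proof (rule normal_generateI)
  show "(\<Union>h\<in>carrier G. (\<lambda>r. h \<otimes> r \<otimes> inv h) ` R) \<subseteq> carrier G"
    using assms by auto
next
  fix x g
  assume "x \<in> (\<Union>h\<in>carrier G. (\<lambda>r. h \<otimes> r \<otimes> inv h) ` R)" and g: "g \<in> carrier G"
  then obtain h r where h: "h \<in> carrier G" and r: "r \<in> R" and x: "x = h \<otimes> r \<otimes> inv h"
    by auto
  have "g \<otimes> x \<otimes> inv g = (g \<otimes> h) \<otimes> r \<otimes> inv (g \<otimes> h)"
    using g h r assms by (auto simp: x inv_mult_group m_assoc subset_iff)
  then show "g \<otimes> x \<otimes> inv g \<in> (\<Union>h\<in>carrier G. (\<lambda>r. h \<otimes> r \<otimes> inv h) ` R)"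
    using g h r by blast
qed

lemma group_presented_group:
  assumes "R \<subseteq> carrier (free_group S)"
  shows "group (presented_group S R)"
  unfolding presented_group_def
  by (intro normal.factorgroup_is_group group.normal_normal_closure group_free_group assms)

section \<open>Surface groups\<close>

datatype surface_generator = GenA nat | GenB nat

definition surface_generators :: "nat \<Rightarrow> surface_generator set" where
  "surface_generators g = GenA ` {1..g} \<union> GenB ` {1..g}"

definition commutator_word :: "'a \<Rightarrow> 'a \<Rightarrow> 'a word" where
  "commutator_word a b = [(a, True), (b, True), (a, False), (b, False)]"

definition surface_relator :: "nat \<Rightarrow> surface_generator word" where
  "surface_relator g = concat (map (\<lambda>i. commutator_word (GenA i) (GenB i)) [1..<Suc g])"

definition surface_group :: "nat \<Rightarrow> surface_generator word set monoid" where
  "surface_group g = presented_group (surface_generators g) {surface_relator g}"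

lemma surface_relator_in_carrier:
  "surface_relator g \<in> carrier (free_group (surface_generators g))"
proof -
  have "reduced_word (surface_relator g) \<and> (g > 0 \<longrightarrow> last (surface_relator g) = (GenB g, False))"
    unfolding reduced_word_def surface_relator_def
    by (induction g) (auto simp: commutator_word_def successively_append_iff)
  moreover have "set (surface_relator g) \<subseteq> surface_generators g \<times> UNIV"
    by (auto simp: surface_relator_def surface_generators_def commutator_word_def)
  ultimately show ?thesis
    by (simp add: free_group_def)
qed

lemma group_surface_group: "group (surface_group g)"
  unfolding surface_group_def
  by (rule group_presented_group) (simp add: surface_relator_in_carrier)

section \<open>Amenable actions\<close>

text \<open>Only the values of \<open>\<mu>\<close> on subsets of \<open>X\<close> matter.\<close>

definition invariant_mean ::
    "('a, 'c) monoid_scheme \<Rightarrow> 'b set \<Rightarrow> ('a \<Rightarrow> 'b \<Rightarrow> 'b) \<Rightarrow> ('b set \<Rightarrow> real) \<Rightarrow> bool" where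
  "invariant_mean G X \<phi> \<mu> \<longleftrightarrow>
     \<mu> \<in> Pow X \<rightarrow> {0..1} \<and>
     \<mu> X = 1 \<and>
     (\<forall>A B. A \<subseteq> X \<longrightarrow> B \<subseteq> X \<longrightarrow> A \<inter> B = {} \<longrightarrow> \<mu> (A \<union> B) = \<mu> A + \<mu> B) \<and>
     (\<forall>g\<in>carrier G. \<forall>A. A \<subseteq> X \<longrightarrow> \<mu> (\<phi> g ` A) = \<mu> A)"

locale amenable_action = group_action +
  assumes amenable: "\<exists>\<mu>. invariant_mean G E \<phi> \<mu>"

end

theory Submission
  imports Defs "HOL-Analysis.Function_Topology" "HOL-Algebra.Elementary_Groups"
begin

text \<open>
  For genus one the group is abelian, so its regular action, which is always transitive and faithful,
  is amenable: the boxes \<open>{a\<^sup>i b\<^sup>j | i, j \<le> n}\<close> form a Foelner sequence.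

  For genus at least two, start from the disjoint union of the regular action, which is faithful, and an
  amenable action on \<open>\<int>\<^sup>2\<close>: the generators \<open>a\<^sub>1\<close> and \<open>a\<^sub>2\<close> translate by \<open>(1, 0)\<close>, the generator
  \<open>b\<^sub>1\<close> translates by \<open>(0, 1)\<close>, and the others act trivially.  This union is faithful and amenable but has
  two orbits.  They are joined by a surgery that keeps the surface relation.  If a permutation
  \<open>\<sigma>\<close> commutes with \<open>b\<^sub>1\<close>, then replacing \<open>a\<^sub>1\<close> by \<open>a\<^sub>1 \<sigma>\<close> leaves the commutator
  \<open>[a\<^sub>1, b\<^sub>1]\<close> unchanged, hence again gives an action of the surface group
  (\<open>surface_group_hom_twist\<close>).  Take for \<open>\<sigma>\<close> the involution that exchanges the \<open>b\<^sub>1\<close>-orbit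
  \<open>{b\<^sub>1\<^sup>n}\<close> of the identity in the regular part with the \<open>b\<^sub>1\<close>-orbit \<open>{0} \<times> \<int>\<close> in the lattice.

  The new action (\<open>ex_grafted_action\<close>) has all three properties.
  It is amenable because the Foelner boxes of the lattice can be chosen away from the column \<open>{0} \<times> \<int>\<close>.
  It is faithful because a given group element acts by left multiplication at all points of the regular
  part that are far from \<open>{b\<^sub>1\<^sup>n}\<close>, where distance is measured by the homomorphism to \<open>\<int>\<close> that gives the
  first coordinate of the lattice translation.
  It is transitive because the lattice stays connected through \<open>a\<^sub>2\<close> and \<open>b\<^sub>1\<close>, and the edges of the Cayley
  graph that the surgery destroys run from \<open>{b\<^sub>1\<^sup>n}\<close> to \<open>{a\<^sub>1 b\<^sub>1\<^sup>n}\<close>, both of which are now attached to the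
  lattice.  The generator \<open>a\<^sub>2\<close> is essential here: those edges separate the Cayley graph, and without
  \<open>a\<^sub>2\<close> the columns up to \<open>{0} \<times> \<int>\<close> and the columns after it would fall into different orbits.
\<close>

section \<open>Invariant means from Foelner sequences\<close>

text \<open>
  Compactness of the cube \<open>[0,1]\<^sup>I\<close> stands in for an ultrafilter: the filter \<open>G\<close> is finer than the image of
  the sequence, so everything that holds for almost all \<open>m n\<close>, or holds in the limit, carries over to \<open>\<mu>\<close>.
\<close>
lemma cluster_point_of_bounded_functions:
  fixes m :: "nat \<Rightarrow> 'i \<Rightarrow> real"
  assumes "\<And>n i. m n i \<in> {0..1}"
  obtains \<mu> G where "G \<noteq> bot" "G \<le> filtermap m sequentially"
    "\<And>i. ((\<lambda>f. f i) \<longlongrightarrow> \<mu> i) G" "\<And>i. \<mu> i \<in> {0..1}"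
proof -
  have "compactin (product_topology (\<lambda>i::'i. euclidean) UNIV) (PiE UNIV (\<lambda>i. {0..1::real}))"
    by (simp add: compactin_PiE)
  then have "compact (PiE UNIV (\<lambda>i::'i. {0..1::real}))"
    by (simp add: euclidean_product_topology)
  moreover have "filtermap m sequentially \<noteq> bot"
    by (simp add: filtermap_bot_iff)
  moreover have "eventually (\<lambda>f. f \<in> PiE UNIV (\<lambda>i. {0..1})) (filtermap m sequentially)"
    using assms by (auto simp: eventually_filtermap PiE_UNIV_domain)
  ultimately obtain \<mu> where \<mu>: "\<mu> \<in> PiE UNIV (\<lambda>i. {0..1})"
      and G: "inf (nhds \<mu>) (filtermap m sequentially) \<noteq> bot"
    unfolding compact_filter by blast
  have "((\<lambda>f. f i) \<longlongrightarrow> \<mu> i) (inf (nhds \<mu>) (filtermap m sequentially))" for i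
  proof -
    have "((\<lambda>f. f i) \<longlongrightarrow> \<mu> i) (nhds \<mu>)"
    proof (rule topological_tendstoI)
      fix U assume "open U" "\<mu> i \<in> U"
      moreover have "open ((\<lambda>f. f i) -` U :: ('i \<Rightarrow> real) set)"
        by (rule open_vimage[OF \<open>open U\<close>]) simp
      ultimately show "\<forall>\<^sub>F f in nhds \<mu>. f i \<in> U"
        unfolding eventually_nhds by (intro exI[of _ "(\<lambda>f. f i) -` U"]) auto
    qed
    then show ?thesis
      by (rule tendsto_mono[rotated]) simp
  qed
  then show thesis
    using that[of "inf (nhds \<mu>) (filtermap m sequentially)" \<mu>] G \<mu> by (auto simp: PiE_iff)
qed

text \<open>
  One inequality comes from pushing \<open>A \<inter> F\<close> forward by \<open>f\<close>, where only points of \<open>f ` F - F\<close> are lost.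
  The other one is the same inequality for the complement of \<open>A\<close>, so that the preimage of \<open>F\<close> never
  has to be compared with \<open>F\<close>.
\<close>
lemma card_image_Int_diff_le:
  fixes F :: "'x set"
  assumes "bij_betw f X X" "finite F" "F \<subseteq> X" "A \<subseteq> X"
  shows "\<bar>real (card (f ` A \<inter> F)) - real (card (A \<inter> F))\<bar> \<le> real (card (f ` F - F))"
proof -
  have le: "card (B \<inter> F) \<le> card (f ` B \<inter> F) + card (f ` F - F)" if "B \<subseteq> X" for B
  proof -
    have "inj_on f (B \<inter> F)"
      using assms(1) that by (auto simp: bij_betw_def intro: inj_on_subset)
    then have "card (B \<inter> F) = card (f ` (B \<inter> F))"
      by (simp add: card_image)
    also have "\<dots> \<le> card ((f ` B \<inter> F) \<union> (f ` F - F))"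
      using assms(2) by (intro card_mono) auto
    also have "\<dots> \<le> card (f ` B \<inter> F) + card (f ` F - F)"
      by (rule card_Un_le)
    finally show ?thesis .
  qed
  have compl: "card ((X - B) \<inter> F) + card (B \<inter> F) = card F" for B
  proof -
    have "F = ((X - B) \<inter> F) \<union> (B \<inter> F)" using assms(3) by auto
    then show ?thesis
      using assms(2) by (metis (no_types, lifting) Diff_disjoint Int_Un_distrib2 Int_assoc Int_commute
            card_Un_disjoint finite_Int inf_bot_right)
  qed
  have "f ` (X - A) = X - f ` A"
    using assms(1,4) by (simp add: bij_betw_def inj_on_image_set_diff[of f X])
  then show ?thesis
    using le[OF assms(4)] le[of "X - A"] compl[of A] compl[of "f ` A"] by auto
qed

text \<open>
  The mean is a cluster point of the normalised counting measures on the sets \<open>F n\<close>.  The Foelner condition is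
  needed for generators only, because the elements that preserve a given mean form a subgroup.
\<close>
lemma amenable_action_of_foelner_sequence:
  fixes G (structure) and F :: "nat \<Rightarrow> 'x set"
  assumes act: "group_action G X \<phi>"
    and gen: "carrier G = generate G S" and S: "S \<subseteq> carrier G"
    and F: "\<And>n. finite (F n)" "\<And>n. F n \<noteq> {}" "\<And>n. F n \<subseteq> X"
    and foelner: "\<And>s. s \<in> S \<Longrightarrow> (\<lambda>n. card (\<phi> s ` F n - F n) / card (F n)) \<longlonglongrightarrow> 0"
  shows "amenable_action G X \<phi>"
proof -
  interpret group_action G X \<phi> by fact
  interpret group G using group_hom by (simp add: group_hom_def)
  have card_pos: "card (F n) > 0" for n
    using F by (simp add: card_gt_0_iff)
  define m where "m n A = card (A \<inter> F n) / card (F n)" for n A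
  have m_bound: "m n A \<in> {0..1}" for n A
    using F(1) card_mono[of "F n" "A \<inter> F n"] by (auto simp: m_def divide_simps)
  obtain \<mu> U where U: "U \<noteq> bot" "U \<le> filtermap m sequentially"
      and lim: "\<And>A. ((\<lambda>f. f A) \<longlongrightarrow> \<mu> A) U" and bound: "\<And>A. \<mu> A \<in> {0..1}"
    using cluster_point_of_bounded_functions[of m] m_bound by metis
  have along: "(h \<longlongrightarrow> l) U" if "(\<lambda>n. h (m n)) \<longlonglongrightarrow> l" for h :: "('x set \<Rightarrow> real) \<Rightarrow> real" and l
    using that U(2) by (auto simp: filterlim_filtermap intro: tendsto_mono)
  have unique: "l = l'" if "(h \<longlongrightarrow> l) U" "(\<lambda>n. h (m n)) \<longlonglongrightarrow> l'" for h :: "('x set \<Rightarrow> real) \<Rightarrow> real" and l l'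
    using tendsto_unique[OF U(1) that(1) along[OF that(2)]] .
  have total: "\<mu> X = 1"
  proof (rule unique[OF lim])
    have "m n X = 1" for n
      using card_pos[of n] F(3)[of n] by (simp add: m_def Int_absorb1)
    then show "(\<lambda>n. m n X) \<longlonglongrightarrow> 1" by simp
  qed
  have additive: "\<mu> (A \<union> B) = \<mu> A + \<mu> B" if "A \<inter> B = {}" for A B
  proof -
    have "m n (A \<union> B) - (m n A + m n B) = 0" for n
    proof -
      have "card ((A \<union> B) \<inter> F n) = card (A \<inter> F n) + card (B \<inter> F n)"
        using that F(1) by (subst card_Un_disjoint[symmetric]) (auto simp: Int_Un_distrib2)
      then show ?thesis by (simp add: m_def add_divide_distrib)
    qed
    then have "\<mu> (A \<union> B) - (\<mu> A + \<mu> B) = 0"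
      by (intro unique[of "\<lambda>f. f (A \<union> B) - (f A + f B)"] tendsto_intros lim) simp
    then show ?thesis by simp
  qed
  have invariant_gen: "\<mu> (\<phi> s ` A) = \<mu> A" if s: "s \<in> S" and A: "A \<subseteq> X" for s A
  proof -
    have "bij_betw (\<phi> s) X X"
      using bij_prop0[of s] s S by (auto simp: Bij_def)
    then have "\<bar>m n (\<phi> s ` A) - m n A\<bar> \<le> card (\<phi> s ` F n - F n) / card (F n)" for n
      using card_image_Int_diff_le[OF _ F(1) F(3) A, of "\<phi> s" n] card_pos[of n]
      by (simp add: m_def divide_right_mono flip: diff_divide_distrib)
    then have "(\<lambda>n. m n (\<phi> s ` A) - m n A) \<longlonglongrightarrow> 0"
      by (intro tendsto_0_le[OF foelner[OF s], of _ 1] always_eventually allI) simp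
    then have "\<mu> (\<phi> s ` A) - \<mu> A = 0"
      by (rule unique[of "\<lambda>f. f (\<phi> s ` A) - f A", rotated]) (intro tendsto_intros lim)
    then show ?thesis by simp
  qed
  have invariant: "\<forall>A. A \<subseteq> X \<longrightarrow> \<mu> (\<phi> x ` A) = \<mu> A" if "x \<in> generate G S" for x
    using that
  proof induction
    case one
    have "\<phi> \<one> ` A = A" if "A \<subseteq> X" for A
      using that by (auto simp: id_eq_one[symmetric] subset_iff image_iff)
    then show ?case by simp
  next
    case (incl s)
    then show ?case using invariant_gen by simp
  next
    case (inv s)
    show ?case
    proof (intro allI impI)
      fix A assume A: "A \<subseteq> X"
      have sc: "s \<in> carrier G" using inv S by auto
      have sub: "\<phi> (inv s) ` A \<subseteq> X"
        using A sc surj_prop[of "inv s"] by auto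
      have "\<phi> s ` \<phi> (inv s) ` A = A"
      proof -
        have "\<phi> s (\<phi> (inv s) x) = x" if "x \<in> A" for x
          using composition_rule[of x s "inv s"] that A sc id_eq_one[symmetric] by auto
        then show ?thesis by (force simp: image_image)
      qed
      then show "\<mu> (\<phi> (inv s) ` A) = \<mu> A"
        using invariant_gen[OF inv sub] by simp
    qed
  next
    case (eng x y)
    show ?case
    proof (intro allI impI)
      fix A assume A: "A \<subseteq> X"
      have xy: "x \<in> carrier G" "y \<in> carrier G" using eng gen by auto
      have "\<phi> (x \<otimes> y) ` A = \<phi> x ` \<phi> y ` A"
        using composition_rule[OF _ xy] A by (force simp: image_image)
      moreover have "\<phi> y ` A \<subseteq> X" using A xy surj_prop[of y] by auto
      ultimately show "\<mu> (\<phi> (x \<otimes> y) ` A) = \<mu> A"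
        using eng A by simp
    qed
  qed
  show ?thesis
  proof
    show "\<exists>\<mu>. invariant_mean G X \<phi> \<mu>"
      unfolding invariant_mean_def using bound total additive invariant gen
      by (intro exI[of _ \<mu>]) auto
  qed
qed

text \<open>
  A copy of the quarter lattice on which each generator acts as a unit shift or trivially is enough for
  amenability, whatever happens elsewhere: the boundary of a box of side \<open>n\<close> has order \<open>n\<close>, its size is of
  order \<open>n\<^sup>2\<close>.  A quarter, rather than the full lattice, allows the copy to avoid a column.
\<close>
lemma amenable_action_of_quarter_lattice:
  fixes G (structure) and f :: "nat \<times> nat \<Rightarrow> 'x"
  assumes act: "group_action G X \<phi>"
    and gen: "carrier G = generate G S" and S: "S \<subseteq> carrier G"
    and f: "inj f" "range f \<subseteq> X"
    and shift: "\<And>s. s \<in> S \<Longrightarrow> (\<forall>i j. \<phi> s (f (i, j)) = f (i, j)) \<or>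
        (\<forall>i j. \<phi> s (f (i, j)) = f (Suc i, j)) \<or> (\<forall>i j. \<phi> s (f (i, j)) = f (i, Suc j))"
  shows "amenable_action G X \<phi>"
proof (rule amenable_action_of_foelner_sequence[OF act gen S])
  define F where "F n = f ` ({..n} \<times> {..n})" for n
  show "finite (F n)" "F n \<noteq> {}" "F n \<subseteq> X" for n
    using f by (auto simp: F_def)
  have cardF: "card (F n) = Suc n * Suc n" for n
    using f by (simp add: F_def card_image inj_on_subset[OF f(1)] card_cartesian_product)
  fix s assume s: "s \<in> S"
  have bound: "card (\<phi> s ` F n - F n) \<le> Suc n" for n
  proof -
    have "\<phi> s ` F n - F n \<subseteq> f ` ({Suc n} \<times> {..n}) \<or> \<phi> s ` F n - F n \<subseteq> f ` ({..n} \<times> {Suc n})"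
      using shift[OF s]
    proof (elim disjE)
      assume "\<forall>i j. \<phi> s (f (i, j)) = f (i, j)"
      then show ?thesis by (auto simp: F_def)
    next
      assume *: "\<forall>i j. \<phi> s (f (i, j)) = f (Suc i, j)"
      have "\<phi> s ` F n - F n \<subseteq> f ` ({Suc n} \<times> {..n})"
      proof
        fix x assume "x \<in> \<phi> s ` F n - F n"
        then obtain i j where ij: "x = f (Suc i, j)" "i \<le> n" "j \<le> n" "x \<notin> F n"
          using * by (auto simp: F_def)
        then have "\<not> Suc i \<le> n" by (auto simp: F_def)
        then have "Suc i = Suc n" using ij by simp
        then show "x \<in> f ` ({Suc n} \<times> {..n})" using ij by auto
      qed
      then show ?thesis ..
    next
      assume *: "\<forall>i j. \<phi> s (f (i, j)) = f (i, Suc j)"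
      have "\<phi> s ` F n - F n \<subseteq> f ` ({..n} \<times> {Suc n})"
      proof
        fix x assume "x \<in> \<phi> s ` F n - F n"
        then obtain i j where ij: "x = f (i, Suc j)" "i \<le> n" "j \<le> n" "x \<notin> F n"
          using * by (auto simp: F_def)
        then have "\<not> Suc j \<le> n" by (auto simp: F_def)
        then have "Suc j = Suc n" using ij by simp
        then show "x \<in> f ` ({..n} \<times> {Suc n})" using ij by auto
      qed
      then show ?thesis ..
    qed
    moreover have "card (f ` ({Suc n} \<times> {..n})) \<le> Suc n" "card (f ` ({..n} \<times> {Suc n})) \<le> Suc n"
      using card_image_le[of "{Suc n} \<times> {..n}" f] card_image_le[of "{..n} \<times> {Suc n}" f]
      by (auto simp: card_cartesian_product)
    ultimately show ?thesis
      by (meson card_mono finite_SigmaI finite_atMost finite.intros finite_imageI le_trans)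
  qed
  have "norm (card (\<phi> s ` F n - F n) / card (F n)) \<le> inverse (real (Suc n))" for n
  proof -
    have "card (\<phi> s ` F n - F n) / card (F n) \<le> real (Suc n) / (real (Suc n) * real (Suc n))"
      unfolding cardF of_nat_mult using bound[of n] by (intro divide_right_mono) (auto simp del: of_nat_Suc)
    also have "\<dots> = inverse (real (Suc n))"
      by (simp add: divide_simps del: of_nat_Suc)
    finally show ?thesis by simp
  qed
  then show "(\<lambda>n. card (\<phi> s ` F n - F n) / card (F n)) \<longlonglongrightarrow> 0"
    by (intro tendsto_0_le[OF LIMSEQ_inverse_real_of_nat, of _ 1] always_eventually allI) simp
qed

section \<open>Constructing and transporting group actions\<close>

text \<open>
  Bijectivity is free: the inverse of \<open>\<phi> x\<close> is \<open>\<phi> (inv x)\<close>.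
\<close>
lemma group_actionI:
  fixes G (structure)
  assumes "group G"
    and ext: "\<And>x. x \<in> carrier G \<Longrightarrow> \<phi> x \<in> extensional E"
    and closed: "\<And>x p. x \<in> carrier G \<Longrightarrow> p \<in> E \<Longrightarrow> \<phi> x p \<in> E"
    and one: "\<And>p. p \<in> E \<Longrightarrow> \<phi> \<one> p = p"
    and mult: "\<And>x y p. x \<in> carrier G \<Longrightarrow> y \<in> carrier G \<Longrightarrow> p \<in> E \<Longrightarrow> \<phi> (x \<otimes> y) p = \<phi> x (\<phi> y p)"
  shows "group_action G E \<phi>"
proof -
  interpret group G by fact
  have inverse: "\<phi> x (\<phi> (inv x) p) = p" "\<phi> (inv x) (\<phi> x p) = p" if "x \<in> carrier G" "p \<in> E" for x p
    using that mult[of x "inv x" p] mult[of "inv x" x p] one by auto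
  have bij: "\<phi> x \<in> Bij E" if x: "x \<in> carrier G" for x
    unfolding Bij_def
  proof (intro IntI CollectI ext x)
    show "bij_betw (\<phi> x) E E"
      by (rule bij_betw_byWitness[of _ "\<phi> (inv x)"]) (use inverse closed x in auto)
  qed
  have "\<phi> (x \<otimes> y) = compose E (\<phi> x) (\<phi> y)" if "x \<in> carrier G" "y \<in> carrier G" for x y
    using that by (intro extensionalityI[of _ E]) (auto simp: ext mult compose_def)
  then have "\<phi> \<in> hom G (BijGroup E)"
    using bij by (auto simp: hom_def BijGroup_def)
  then show ?thesis
    by (simp add: group_action_def group_hom_def group_hom_axioms_def group_BijGroup is_group)
qed

text \<open>
  All three properties are invariant under a relabelling of the points, so a countable set
  can be replaced by a set of natural numbers.
\<close>
lemma ex_action_on_nat_set: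
  fixes G (structure)
  assumes X: "countable X" and trans: "transitive_action G X \<phi>" and faith: "faithful_action G X \<phi>"
    and amen: "amenable_action G X \<phi>"
  shows "\<exists>(Y :: nat set) \<psi>. transitive_action G Y \<psi> \<and> faithful_action G Y \<psi> \<and> amenable_action G Y \<psi>"
proof -
  interpret transitive_action G X \<phi> by fact
  interpret F: faithful_action G X \<phi> by fact
  interpret A: amenable_action G X \<phi> by fact
  interpret group G using group_hom by (simp add: group_hom_def)
  define \<theta> where "\<theta> = to_nat_on X"
  define \<eta> where "\<eta> = inv_into X \<theta>"
  define Y where "Y = \<theta> ` X"
  define \<psi> where "\<psi> x = (\<lambda>n\<in>Y. \<theta> (\<phi> x (\<eta> n)))" for x
  have inj: "inj_on \<theta> X"
    using X unfolding \<theta>_def by (rule inj_on_to_nat_on)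
  have \<eta>\<theta>: "\<eta> (\<theta> p) = p" if "p \<in> X" for p
    using inj that by (simp add: \<eta>_def)
  have closed: "\<phi> x p \<in> X" if "x \<in> carrier G" "p \<in> X" for x p
    using element_image[OF that refl] .
  have \<psi>\<theta>: "\<psi> x (\<theta> p) = \<theta> (\<phi> x p)" if "p \<in> X" for x p
    using that by (simp add: \<psi>_def Y_def \<eta>\<theta>)
  have one: "\<phi> \<one> p = p" if "p \<in> X" for p
    using that by (simp add: id_eq_one[symmetric])
  have "group_action G Y \<psi>"
  proof (rule group_actionI[OF is_group])
    show "\<psi> x \<in> extensional Y" for x by (simp add: \<psi>_def)
  qed (auto simp: Y_def \<psi>\<theta> closed one composition_rule)
  then interpret B: group_action G Y \<psi> .
  have "transitive_action G Y \<psi>"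
  proof
    fix u v assume "u \<in> Y" "v \<in> Y"
    then obtain p q where pq: "p \<in> X" "q \<in> X" "u = \<theta> p" "v = \<theta> q" by (auto simp: Y_def)
    obtain x where "x \<in> carrier G" "\<phi> x p = q" using unique_orbit pq by blast
    then show "\<exists>x\<in>carrier G. \<psi> x u = v" using pq by (auto simp: \<psi>\<theta>)
  qed
  moreover have "faithful_action G Y \<psi>"
  proof
    show "inj_on \<psi> (carrier G)"
    proof (rule inj_onI)
      fix x y assume xy: "x \<in> carrier G" "y \<in> carrier G" "\<psi> x = \<psi> y"
      have "\<phi> x p = \<phi> y p" if "p \<in> X" for p
        using \<psi>\<theta>[OF that, of x] \<psi>\<theta>[OF that, of y] xy that closed inj by (auto dest: inj_onD)
      then have "\<phi> x = \<phi> y"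
        using bij_prop0[OF xy(1)] bij_prop0[OF xy(2)] by (intro extensionalityI[of _ X]) (auto simp: Bij_def)
      then show "x = y" using F.faithful xy by (auto dest: inj_onD)
    qed
  qed
  moreover have "amenable_action G Y \<psi>"
  proof
    obtain \<mu> where \<mu>: "invariant_mean G X \<phi> \<mu>" using A.amenable by blast
    have sub: "\<eta> ` A \<subseteq> X" if "A \<subseteq> Y" for A
      using that by (auto simp: Y_def \<eta>\<theta>)
    have "\<eta> ` Y = X" by (force simp: Y_def \<eta>\<theta> image_image)
    moreover have "\<eta> ` A \<inter> \<eta> ` B = {}" if "A \<subseteq> Y" "B \<subseteq> Y" "A \<inter> B = {}" for A B
      using that by (fastforce simp: Y_def \<eta>\<theta>)
    moreover have "\<eta> ` \<psi> x ` A = \<phi> x ` \<eta> ` A" if "x \<in> carrier G" "A \<subseteq> Y" for x A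
    proof -
      have "\<eta> (\<psi> x n) = \<phi> x (\<eta> n)" if "n \<in> A" for n
        using that \<open>A \<subseteq> Y\<close> \<open>x \<in> carrier G\<close> by (auto simp: Y_def \<psi>\<theta> \<eta>\<theta> closed subset_iff)
      then show ?thesis by (simp add: image_image)
    qed
    ultimately have "invariant_mean G Y \<psi> (\<lambda>A. \<mu> (\<eta> ` A))"
      using \<mu> sub unfolding invariant_mean_def by (auto simp: image_Un Pi_iff)
    then show "\<exists>\<mu>. invariant_mean G Y \<psi> \<mu>" by blast
  qed
  ultimately show ?thesis by blast
qed

lemma (in group) transitive_left_regular: "transitive_action G (carrier G) (\<lambda>x. \<lambda>y\<in>carrier G. x \<otimes> y)"
  and faithful_left_regular: "faithful_action G (carrier G) (\<lambda>x. \<lambda>y\<in>carrier G. x \<otimes> y)"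
proof -
  interpret A: group_action G "carrier G" "\<lambda>x. \<lambda>y\<in>carrier G. x \<otimes> y"
    by (rule group_actionI) (auto simp: m_assoc)
  show "transitive_action G (carrier G) (\<lambda>x. \<lambda>y\<in>carrier G. x \<otimes> y)"
  proof
    fix x y assume "x \<in> carrier G" "y \<in> carrier G"
    then show "\<exists>z\<in>carrier G. (\<lambda>y\<in>carrier G. z \<otimes> y) x = y"
      by (intro bexI[of _ "y \<otimes> inv x"]) (auto simp: m_assoc)
  qed
  show "faithful_action G (carrier G) (\<lambda>x. \<lambda>y\<in>carrier G. x \<otimes> y)"
  proof
    show "inj_on (\<lambda>x. \<lambda>y\<in>carrier G. x \<otimes> y) (carrier G)"
    proof (rule inj_onI)
      fix x y assume "x \<in> carrier G" "y \<in> carrier G" "(\<lambda>z\<in>carrier G. x \<otimes> z) = (\<lambda>z\<in>carrier G. y \<otimes> z)"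
      then show "x = y" by (metis one_closed r_one restrict_apply')
    qed
  qed
qed

lemma BijGroup_mult_apply:
  assumes "f \<in> carrier (BijGroup X)" "g \<in> carrier (BijGroup X)" "x \<in> X"
  shows "(f \<otimes>\<^bsub>BijGroup X\<^esub> g) x = f (g x)"
  using assms by (simp add: BijGroup_def compose_eq)

section \<open>Homomorphisms out of a presented group\<close>

text \<open>
  Allowing words that are not reduced makes this multiplicative for concatenation as well as for the product of the
  free group.
\<close>
definition eval_word :: "('b, 'c) monoid_scheme \<Rightarrow> ('a \<Rightarrow> 'b) \<Rightarrow> 'a word \<Rightarrow> 'b" where
  "eval_word H h w = foldr (\<lambda>(s, e) y. (if e then h s else inv\<^bsub>H\<^esub> h s) \<otimes>\<^bsub>H\<^esub> y) w \<one>\<^bsub>H\<^esub>"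

lemma eval_word_Nil [simp]: "eval_word H h [] = \<one>\<^bsub>H\<^esub>"
  and eval_word_Cons: "eval_word H h ((s, e) # w) = (if e then h s else inv\<^bsub>H\<^esub> h s) \<otimes>\<^bsub>H\<^esub> eval_word H h w"
  by (simp_all add: eval_word_def)

lemma eval_word_cong:
  "(\<And>s e. (s, e) \<in> set w \<Longrightarrow> h s = h' s) \<Longrightarrow> eval_word H h w = eval_word H h' w"
  by (induction w) (fastforce simp: eval_word_Cons)+

context group
begin

lemma eval_word_closed:
  assumes "h \<in> S \<rightarrow> carrier G" "set w \<subseteq> S \<times> UNIV"
  shows "eval_word G h w \<in> carrier G"
  using assms(2) by (induction w) (use assms(1) in \<open>auto simp: eval_word_Cons Pi_iff\<close>)

lemma eval_word_append:
  assumes "h \<in> S \<rightarrow> carrier G" "set u \<subseteq> S \<times> UNIV" "set v \<subseteq> S \<times> UNIV"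
  shows "eval_word G h (u @ v) = eval_word G h u \<otimes> eval_word G h v"
  using assms(2)
proof (induction u)
  case Nil
  then show ?case using eval_word_closed[OF assms(1,3)] by simp
next
  case (Cons x u)
  then show ?case
    using assms(1) eval_word_closed[OF assms(1,3)] eval_word_closed[OF assms(1), of u]
    by (cases x) (auto simp: eval_word_Cons m_assoc Pi_iff)
qed

lemma eval_word_push_letter:
  assumes "h \<in> S \<rightarrow> carrier G" "set (x # w) \<subseteq> S \<times> UNIV"
  shows "eval_word G h (push_letter x w) = eval_word G h (x # w)"
proof (cases w)
  case (Cons y v)
  have "h (fst x) \<in> carrier G" "eval_word G h v \<in> carrier G"
    using assms Cons eval_word_closed[OF assms(1), of v] by (auto simp: Pi_iff)
  then show ?thesis
    using Cons by (cases x) (auto simp: eval_word_Cons simp flip: m_assoc)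
qed (use assms in simp)

lemma eval_word_hom:
  assumes "h \<in> S \<rightarrow> carrier G"
  shows "eval_word G h \<in> hom (free_group S) G"
proof (rule homI)
  fix u v assume "u \<in> carrier (free_group S)" "v \<in> carrier (free_group S)"
  then have u: "set u \<subseteq> S \<times> UNIV" and v: "set v \<subseteq> S \<times> UNIV"
    by (auto simp: free_group_def)
  from u have "eval_word G h (foldr push_letter u v) = eval_word G h (u @ v)"
  proof (induction u)
    case (Cons x u)
    have "set (x # foldr push_letter u v) \<subseteq> S \<times> UNIV"
      using set_foldr_push_letter[of u v] Cons.prems v by auto
    from eval_word_push_letter[OF assms this] show ?case
      using Cons by (cases x) (simp add: eval_word_Cons)
  qed simp
  then show "eval_word G h (u \<otimes>\<^bsub>free_group S\<^esub> v) = eval_word G h u \<otimes> eval_word G h v"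
    using eval_word_append[OF assms u v] by (simp add: free_group_def)
qed (use eval_word_closed[OF assms] in \<open>auto simp: free_group_def\<close>)

end

definition presented_generator :: "'a set \<Rightarrow> 'a word set \<Rightarrow> 'a \<Rightarrow> 'a word set" where
  "presented_generator S R s = normal_closure (free_group S) R #>\<^bsub>free_group S\<^esub> [(s, True)]"

lemma letter_in_free_group: "s \<in> S \<Longrightarrow> [(s, e)] \<in> carrier (free_group S)"
  by (simp add: free_group_def reduced_word_def)

lemma inv_letter_free_group: "s \<in> S \<Longrightarrow> inv\<^bsub>free_group S\<^esub> [(s, True)] = [(s, False)]"
  using group.inv_equality[OF group_free_group[of S], of "[(s, False)]" "[(s, True)]"] letter_in_free_group[of s S]
  by (simp add: free_group_def)

text \<open>
  The universal property of a presentation.  Evaluation is a homomorphism on the free group, its kernel is normal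
  and contains the relators, hence it contains their normal closure.
\<close>
lemma presented_group_hom_ext:
  assumes "group H" "R \<subseteq> carrier (free_group S)" "h \<in> S \<rightarrow> carrier H"
    and rel: "\<And>r. r \<in> R \<Longrightarrow> eval_word H h r = \<one>\<^bsub>H\<^esub>"
  obtains \<phi> where "\<phi> \<in> hom (presented_group S R) H"
    "\<And>s. s \<in> S \<Longrightarrow> \<phi> (presented_generator S R s) = h s"
proof -
  interpret H: group H by fact
  interpret F: group "free_group S" by (rule group_free_group)
  let ?N = "normal_closure (free_group S) R" and ?e = "eval_word H h"
  interpret e: group_hom "free_group S" H ?e
    by (intro group_hom.intro group_hom_axioms.intro H.eval_word_hom assms F.is_group)
  have "?N \<subseteq> kernel (free_group S) H ?e"
    unfolding normal_closure_def
  proof (rule F.generate_subgroup_incl[OF _ e.subgroup_kernel])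
    show "(\<Union>x\<in>carrier (free_group S). (\<lambda>r. x \<otimes>\<^bsub>free_group S\<^esub> r \<otimes>\<^bsub>free_group S\<^esub> inv\<^bsub>free_group S\<^esub> x) ` R)
        \<subseteq> kernel (free_group S) H ?e"
      using assms(2) by (auto simp: kernel_def rel subset_iff)
  qed
  then have ker: "?e x = \<one>\<^bsub>H\<^esub>" if "x \<in> ?N" for x
    using that by (auto simp: kernel_def)
  have N: "?N \<lhd> free_group S"
    by (rule F.normal_normal_closure) fact
  then have Nc: "?N \<subseteq> carrier (free_group S)"
    by (meson normal_def subgroup.subset)
  have "?e x = ?e y"
    if xy: "x \<in> carrier (free_group S)" "y \<in> carrier (free_group S)"
      and eq: "?N #>\<^bsub>free_group S\<^esub> x = ?N #>\<^bsub>free_group S\<^esub> y" for x y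
  proof -
    have "x \<in> ?N #>\<^bsub>free_group S\<^esub> y"
      using F.rcos_self[OF xy(1) normal_imp_subgroup[OF N]] eq by simp
    then obtain n where "n \<in> ?N" "x = n \<otimes>\<^bsub>free_group S\<^esub> y" by (auto simp: r_coset_def)
    then show ?thesis using ker[of n] Nc xy by (auto simp: subset_iff)
  qed
  then obtain \<phi> where "\<phi> \<in> hom (free_group S Mod ?N) H"
      "\<And>x. x \<in> carrier (free_group S) \<Longrightarrow> \<phi> (?N #>\<^bsub>free_group S\<^esub> x) = ?e x"
    using FactGroup_universal[OF e.homh N] by metis
  moreover have "?e [(s, True)] = h s" if "s \<in> S" for s
    using funcset_mem[OF assms(3) that] by (simp add: eval_word_Cons)
  ultimately show thesis
    using that by (simp add: presented_group_def presented_generator_def letter_in_free_group)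
qed

lemma presented_generator_closed:
  assumes "s \<in> S"
  shows "presented_generator S R s \<in> carrier (presented_group S R)"
  using letter_in_free_group[OF assms]
  by (auto simp: presented_generator_def presented_group_def carrier_FactGroup)

text \<open>
  Evaluating a reduced word at the generators of the presented group gives its coset.
  This yields both that the generators generate and that relators vanish under every homomorphism.
\<close>
lemma eval_word_presented_generator:
  assumes R: "R \<subseteq> carrier (free_group S)" and w: "w \<in> carrier (free_group S)"
  shows "eval_word (presented_group S R) (presented_generator S R) w
       = normal_closure (free_group S) R #>\<^bsub>free_group S\<^esub> w"
proof -
  let ?N = "normal_closure (free_group S) R"
  interpret F: group "free_group S" by (rule group_free_group)
  interpret P: group "presented_group S R" by (rule group_presented_group[OF R])
  interpret N: normal ?N "free_group S" by (rule F.normal_normal_closure[OF R])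
  have q: "(\<lambda>w. ?N #>\<^bsub>free_group S\<^esub> w) \<in> hom (free_group S) (presented_group S R)"
    unfolding presented_group_def by (rule N.r_coset_hom_Mod)
  then interpret q: group_hom "free_group S" "presented_group S R" "\<lambda>w. ?N #>\<^bsub>free_group S\<^esub> w"
    by (intro group_hom.intro group_hom_axioms.intro F.is_group P.is_group)
  show ?thesis using w
  proof (induction w)
    case Nil
    then show ?case using q.hom_one by (simp add: free_group_def)
  next
    case (Cons x w)
    obtain s e where x: "x = (s, e)" by (cases x)
    have s: "s \<in> S" and w: "w \<in> carrier (free_group S)" and xw: "reduced_word (x # w)"
      using Cons.prems x by (auto simp: free_group_def dest: reduced_word_ConsD)
    have "[x] \<otimes>\<^bsub>free_group S\<^esub> w = x # w"
      using xw by (cases w) (auto simp: free_group_def reduced_word_def)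
    moreover have "?N #>\<^bsub>free_group S\<^esub> [x] = (if e then presented_generator S R s
        else inv\<^bsub>presented_group S R\<^esub> presented_generator S R s)"
      using q.hom_inv[OF letter_in_free_group[OF s, of True]]
      by (simp add: presented_generator_def x inv_letter_free_group[OF s])
    ultimately show ?case
      using q.hom_mult[OF letter_in_free_group[OF s, of e] w] Cons.IH[OF w]
      by (simp add: x eval_word_Cons)
  qed
qed

lemma generate_presented_generator:
  assumes R: "R \<subseteq> carrier (free_group S)"
  shows "carrier (presented_group S R) = generate (presented_group S R) (presented_generator S R ` S)"
proof (rule equalityI)
  interpret P: group "presented_group S R" by (rule group_presented_group[OF R])
  have sub: "presented_generator S R ` S \<subseteq> carrier (presented_group S R)"
    by (intro image_subsetI presented_generator_closed)
  show "generate (presented_group S R) (presented_generator S R ` S) \<subseteq> carrier (presented_group S R)"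
    by (rule P.generate_incl[OF sub])
  have "eval_word (presented_group S R) (presented_generator S R) w
      \<in> generate (presented_group S R) (presented_generator S R ` S)" if "set w \<subseteq> S \<times> UNIV" for w
    using that
  proof (induction w)
    case (Cons x w)
    then show ?case
      by (cases x) (auto simp: eval_word_Cons intro!: generate.eng intro: generate.incl generate.inv)
  qed (auto intro: generate.one)
  moreover have "set w \<subseteq> S \<times> UNIV" if "w \<in> carrier (free_group S)" for w
    using that by (simp add: free_group_def)
  ultimately have "normal_closure (free_group S) R #>\<^bsub>free_group S\<^esub> w
      \<in> generate (presented_group S R) (presented_generator S R ` S)" if "w \<in> carrier (free_group S)" for w
    using eval_word_presented_generator[OF R that] that by metis
  then show "carrier (presented_group S R) \<subseteq> generate (presented_group S R) (presented_generator S R ` S)"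
    by (auto simp: carrier_FactGroup presented_group_def)
qed

lemma countable_presented_group:
  assumes "countable S"
  shows "countable (carrier (presented_group S R))"
proof -
  have "carrier (free_group S) \<subseteq> lists (S \<times> UNIV)"
    by (auto simp: free_group_def)
  then have "countable (carrier (free_group S))"
    by (rule countable_subset) (use assms in simp)
  then show ?thesis by (simp add: presented_group_def carrier_FactGroup)
qed

lemma eval_relator_image:
  assumes R: "R \<subseteq> carrier (free_group S)" and "r \<in> R" and "group H" "\<phi> \<in> hom (presented_group S R) H"
  shows "eval_word H (\<lambda>s. \<phi> (presented_generator S R s)) r = \<one>\<^bsub>H\<^esub>"
proof -
  interpret P: group "presented_group S R" by (rule group_presented_group[OF R])
  interpret F: group "free_group S" by (rule group_free_group)
  interpret group_hom "presented_group S R" H \<phi>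
    by (intro group_hom.intro group_hom_axioms.intro P.is_group assms)
  have r: "r \<in> carrier (free_group S)" using assms by auto
  have "eval_word H (\<lambda>s. \<phi> (presented_generator S R s)) w
      = \<phi> (eval_word (presented_group S R) (presented_generator S R) w)" if "set w \<subseteq> S \<times> UNIV" for w
    using that
  proof (induction w)
    case (Cons x w)
    have "eval_word (presented_group S R) (presented_generator S R) w \<in> carrier (presented_group S R)"
      by (rule P.eval_word_closed[of _ S]) (use Cons.prems presented_generator_closed in auto)
    then show ?case
      using Cons presented_generator_closed[of "fst x" S R] by (cases x) (auto simp: eval_word_Cons)
  qed simp
  then have "eval_word H (\<lambda>s. \<phi> (presented_generator S R s)) r
      = \<phi> (normal_closure (free_group S) R #>\<^bsub>free_group S\<^esub> r)"
    using r eval_word_presented_generator[OF R r] by (auto simp: free_group_def)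
  also have "r \<in> normal_closure (free_group S) R"
  proof -
    have "\<one>\<^bsub>free_group S\<^esub> \<otimes>\<^bsub>free_group S\<^esub> r \<otimes>\<^bsub>free_group S\<^esub> inv\<^bsub>free_group S\<^esub> \<one>\<^bsub>free_group S\<^esub> = r"
      using r by simp
    then show ?thesis unfolding normal_closure_def
      using assms(2) by (intro generate.incl) force
  qed
  then have "normal_closure (free_group S) R #>\<^bsub>free_group S\<^esub> r = \<one>\<^bsub>presented_group S R\<^esub>"
    using F.normal_normal_closure[OF R] F.coset_join2[OF r] by (simp add: presented_group_def normal_def)
  finally show ?thesis by simp
qed

section \<open>Homomorphisms out of a surface group\<close>

declare One_nat_def [simp del]

definition surface_gen :: "nat \<Rightarrow> surface_generator \<Rightarrow> surface_generator word set" where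
  "surface_gen g = presented_generator (surface_generators g) {surface_relator g}"

lemma surface_group_hom_ext:
  assumes "group H" "h \<in> surface_generators g \<rightarrow> carrier H" "eval_word H h (surface_relator g) = \<one>\<^bsub>H\<^esub>"
  obtains \<phi> where "\<phi> \<in> hom (surface_group g) H"
    "\<And>s. s \<in> surface_generators g \<Longrightarrow> \<phi> (surface_gen g s) = h s"
  using presented_group_hom_ext[of H "{surface_relator g}" "surface_generators g" h] assms
  by (auto simp: surface_group_def surface_gen_def surface_relator_in_carrier)

lemma surface_gen_closed: "s \<in> surface_generators g \<Longrightarrow> surface_gen g s \<in> carrier (surface_group g)"
  unfolding surface_gen_def surface_group_def by (rule presented_generator_closed)

lemma generate_surface_gen:
  "carrier (surface_group g) = generate (surface_group g) (surface_gen g ` surface_generators g)"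
  unfolding surface_gen_def surface_group_def
  by (rule generate_presented_generator) (simp add: surface_relator_in_carrier)

lemma eval_surface_relator_image:
  assumes "group H" "\<phi> \<in> hom (surface_group g) H"
  shows "eval_word H (\<lambda>s. \<phi> (surface_gen g s)) (surface_relator g) = \<one>\<^bsub>H\<^esub>"
  using assms eval_relator_image[of "{surface_relator g}" "surface_generators g" "surface_relator g" H \<phi>]
  by (simp add: surface_gen_def surface_group_def surface_relator_in_carrier)

lemma countable_surface_group: "countable (carrier (surface_group g))"
  unfolding surface_group_def by (rule countable_presented_group) (simp add: surface_generators_def)

text \<open>
  The surface relator is a product of commutators, so in an abelian group every assignment satisfies it.
\<close>
lemma surface_group_hom_integers:
  fixes c :: "surface_generator \<Rightarrow> int"
  obtains \<pi> where "\<pi> \<in> hom (surface_group g) integer_group"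
    "\<And>s. s \<in> surface_generators g \<Longrightarrow> \<pi> (surface_gen g s) = c s"
proof -
  have append: "eval_word integer_group c (u @ v) = eval_word integer_group c u + eval_word integer_group c v" for u v
    using group.eval_word_append[OF group_integer_group, of c UNIV u v] by simp
  have "eval_word integer_group c (concat (map (\<lambda>i. commutator_word (GenA i) (GenB i)) is)) = 0" for "is"
    by (induction "is") (simp_all add: append commutator_word_def eval_word_Cons)
  then have "eval_word integer_group c (surface_relator g) = 0"
    by (simp add: surface_relator_def)
  then show thesis
    using surface_group_hom_ext[OF group_integer_group, where h = c and g = g] that
    by (simp add: Pi_iff) blast
qed

text \<open>
  The surgery: if \<open>\<sigma>\<close> commutes with the image \<open>b\<close> of \<open>b\<^sub>1\<close>, then \<open>[a \<sigma>, b] = a (\<sigma> b \<sigma>\<^sup>-\<^sup>1) a\<^sup>-\<^sup>1 b\<^sup>-\<^sup>1 = [a, b]\<close>.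
  For \<open>\<sigma>\<close> a power of \<open>b\<close> this is a Dehn twist; here \<open>\<sigma>\<close> may be any element of the centraliser of \<open>b\<close>.
\<close>
lemma surface_group_hom_twist:
  assumes "group H" and \<phi>: "\<phi> \<in> hom (surface_group g) H" and g: "g \<ge> 1"
    and \<sigma>: "\<sigma> \<in> carrier H"
    and comm: "\<sigma> \<otimes>\<^bsub>H\<^esub> \<phi> (surface_gen g (GenB 1)) = \<phi> (surface_gen g (GenB 1)) \<otimes>\<^bsub>H\<^esub> \<sigma>"
  obtains \<phi>' where "\<phi>' \<in> hom (surface_group g) H"
    "\<phi>' (surface_gen g (GenA 1)) = \<phi> (surface_gen g (GenA 1)) \<otimes>\<^bsub>H\<^esub> \<sigma>"
    "\<And>s. s \<in> surface_generators g \<Longrightarrow> s \<noteq> GenA 1 \<Longrightarrow> \<phi>' (surface_gen g s) = \<phi> (surface_gen g s)"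
proof -
  interpret H: group H by fact
  let ?S = "surface_generators g"
  define h where "h s = \<phi> (surface_gen g s)" for s
  define h' where "h' = h(GenA 1 := h (GenA 1) \<otimes>\<^bsub>H\<^esub> \<sigma>)"
  have h: "h \<in> ?S \<rightarrow> carrier H"
    using \<phi> surface_gen_closed by (auto simp: h_def hom_def)
  have ab: "GenA 1 \<in> ?S" "GenB 1 \<in> ?S"
    using g by (auto simp: surface_generators_def)
  have h': "h' \<in> ?S \<rightarrow> carrier H"
    using h \<sigma> ab by (auto simp: h'_def Pi_iff)
  define rest where "rest = concat (map (\<lambda>i. commutator_word (GenA i) (GenB i)) [2..<Suc g])"
  have rel: "surface_relator g = commutator_word (GenA 1) (GenB 1) @ rest"
    using g upt_conv_Cons[of 1 "Suc g"] by (simp add: surface_relator_def rest_def del: upt_Suc)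
  have set: "set (commutator_word (GenA 1) (GenB 1)) \<subseteq> ?S \<times> UNIV" "set rest \<subseteq> ?S \<times> UNIV"
    using ab by (auto simp: rest_def commutator_word_def surface_generators_def)
  have "eval_word H h' rest = eval_word H h rest"
    by (rule eval_word_cong) (auto simp: rest_def commutator_word_def h'_def)
  moreover have "eval_word H h' (commutator_word (GenA 1) (GenB 1))
      = eval_word H h (commutator_word (GenA 1) (GenB 1))"
  proof -
    define a b where "a = h (GenA 1)" and "b = h (GenB 1)"
    have [simp]: "a \<in> carrier H" "b \<in> carrier H"
      using h ab by (auto simp: a_def b_def)
    have "\<sigma> \<otimes>\<^bsub>H\<^esub> b = b \<otimes>\<^bsub>H\<^esub> \<sigma>"
      using comm by (simp add: b_def h_def)
    then have "\<sigma> \<otimes>\<^bsub>H\<^esub> b \<otimes>\<^bsub>H\<^esub> inv\<^bsub>H\<^esub> \<sigma> = b"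
      using \<sigma> by (simp add: H.m_assoc)
    then have "(a \<otimes>\<^bsub>H\<^esub> (\<sigma> \<otimes>\<^bsub>H\<^esub> b \<otimes>\<^bsub>H\<^esub> inv\<^bsub>H\<^esub> \<sigma>)) \<otimes>\<^bsub>H\<^esub> inv\<^bsub>H\<^esub> a \<otimes>\<^bsub>H\<^esub> inv\<^bsub>H\<^esub> b
        = a \<otimes>\<^bsub>H\<^esub> b \<otimes>\<^bsub>H\<^esub> inv\<^bsub>H\<^esub> a \<otimes>\<^bsub>H\<^esub> inv\<^bsub>H\<^esub> b"
      by simp
    then show ?thesis
      using \<sigma> by (simp add: commutator_word_def eval_word_Cons h'_def H.inv_mult_group H.m_assoc
          flip: a_def b_def)
  qed
  ultimately have "eval_word H h' (surface_relator g) = eval_word H h (surface_relator g)"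
    using H.eval_word_append[OF h set] H.eval_word_append[OF h' set] by (simp add: rel)
  also have "\<dots> = \<one>\<^bsub>H\<^esub>"
    using eval_surface_relator_image[OF \<open>group H\<close> \<phi>] by (simp add: h_def[abs_def])
  finally obtain \<phi>' where "\<phi>' \<in> hom (surface_group g) H" "\<And>s. s \<in> ?S \<Longrightarrow> \<phi>' (surface_gen g s) = h' s"
    using surface_group_hom_ext[OF \<open>group H\<close> h'] by blast
  then show thesis
    using that[of \<phi>'] ab by (simp add: h'_def h_def)
qed

section \<open>The torus\<close>

lemma hom_integer_pow:
  assumes "group G" "\<pi> \<in> hom G integer_group" "x \<in> carrier G"
  shows "\<pi> (x [^]\<^bsub>G\<^esub> (n::int)) = n * \<pi> x"
proof -
  interpret group_hom G integer_group \<pi>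
    by (intro group_hom.intro group_hom_axioms.intro assms) simp
  show ?thesis using hom_int_pow[OF assms(3), of n] by (simp add: group_int_pow_integer_group)
qed

text \<open>
  The homomorphisms \<open>p\<close> and \<open>q\<close> make the elements \<open>a\<^sup>i b\<^sup>j\<close> pairwise distinct, so these form a quarter lattice on
  which the generators act as unit shifts.
\<close>
lemma (in group) amenable_left_regular_of_commuting_generators:
  assumes gen: "carrier G = generate G {a, b}" and ab: "a \<in> carrier G" "b \<in> carrier G"
    and comm: "a \<otimes> b = b \<otimes> a"
    and p: "p \<in> hom G integer_group" "p a = 1" "p b = 0"
    and q: "q \<in> hom G integer_group" "q a = 0" "q b = 1"
  shows "amenable_action G (carrier G) (\<lambda>x. \<lambda>y\<in>carrier G. x \<otimes> y)"
proof (rule amenable_action_of_quarter_lattice[OF _ gen])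
  define f where "f = (\<lambda>(i::nat, j::nat). a [^] i \<otimes> b [^] j)"
  have pq_f: "p (f (i, j)) = int i" "q (f (i, j)) = int j" for i j
    using hom_integer_pow[OF is_group p(1), of _ "int _"] hom_integer_pow[OF is_group q(1), of _ "int _"] p q ab
    by (auto simp: f_def hom_mult int_pow_int)
  show "group_action G (carrier G) (\<lambda>x. \<lambda>y\<in>carrier G. x \<otimes> y)"
    using transitive_left_regular by (simp add: transitive_action_def)
  show "{a, b} \<subseteq> carrier G" using ab by simp
  show range: "range f \<subseteq> carrier G" using ab by (auto simp: f_def)
  show "inj f"
    using pq_f by (intro injI) (metis of_nat_eq_iff surj_pair)
  have "b \<otimes> a [^] i = a [^] i \<otimes> b" for i :: nat
    using ab comm by (simp add: group_commutes_pow)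
  then have "b \<otimes> f (i, j) = f (i, Suc j)" for i j
    using ab m_assoc[of "a [^] i" b "b [^] j"] nat_pow_Suc2[of b j] by (simp add: f_def flip: m_assoc)
  moreover have "a \<otimes> f (i, j) = f (Suc i, j)" for i j
    using ab m_assoc[of a "a [^] i" "b [^] j"] nat_pow_Suc2[of a i] by (simp add: f_def)
  moreover have "f (i, j) \<in> carrier G" for i j
    using range by auto
  ultimately show "(\<forall>i j. (\<lambda>y\<in>carrier G. s \<otimes> y) (f (i, j)) = f (i, j)) \<or>
      (\<forall>i j. (\<lambda>y\<in>carrier G. s \<otimes> y) (f (i, j)) = f (Suc i, j)) \<or>
      (\<forall>i j. (\<lambda>y\<in>carrier G. s \<otimes> y) (f (i, j)) = f (i, Suc j))" if "s \<in> {a, b}" for s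
    using that by auto
qed

lemma torus_group_commute:
  "surface_gen 1 (GenA 1) \<otimes>\<^bsub>surface_group 1\<^esub> surface_gen 1 (GenB 1)
   = surface_gen 1 (GenB 1) \<otimes>\<^bsub>surface_group 1\<^esub> surface_gen 1 (GenA 1)"
proof -
  interpret group "surface_group 1" by (rule group_surface_group)
  define a b where "a = surface_gen 1 (GenA 1)" and "b = surface_gen 1 (GenB 1)"
  have ab: "a \<in> carrier (surface_group 1)" "b \<in> carrier (surface_group 1)"
    unfolding a_def b_def by (auto intro!: surface_gen_closed simp: surface_generators_def)
  have "(\<lambda>x. x) \<in> hom (surface_group 1) (surface_group 1)"
    by (auto simp: hom_def)
  from eval_surface_relator_image[OF is_group this]
  have "a \<otimes>\<^bsub>surface_group 1\<^esub> b \<otimes>\<^bsub>surface_group 1\<^esub> inv\<^bsub>surface_group 1\<^esub> a \<otimes>\<^bsub>surface_group 1\<^esub> inv\<^bsub>surface_group 1\<^esub> b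
      = \<one>\<^bsub>surface_group 1\<^esub>"
    using ab by (simp add: surface_relator_def commutator_word_def eval_word_Cons m_assoc upt_conv_Cons flip: a_def b_def)
  then show ?thesis
    using ab by (simp add: inv_solve_right' flip: a_def b_def)
qed

lemma torus_left_regular_amenable:
  "amenable_action (surface_group 1) (carrier (surface_group 1)) (\<lambda>x. \<lambda>y\<in>carrier (surface_group 1). x \<otimes>\<^bsub>surface_group 1\<^esub> y)"
proof -
  have S: "surface_generators 1 = {GenA 1, GenB 1}" by (auto simp: surface_generators_def)
  obtain p where p: "p \<in> hom (surface_group 1) integer_group"
      "\<And>s. s \<in> surface_generators 1 \<Longrightarrow> p (surface_gen 1 s) = (if s = GenA 1 then 1 else 0)"
    using surface_group_hom_integers[of 1 "\<lambda>s. if s = GenA 1 then 1 else 0"] by metis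
  obtain q where q: "q \<in> hom (surface_group 1) integer_group"
      "\<And>s. s \<in> surface_generators 1 \<Longrightarrow> q (surface_gen 1 s) = (if s = GenB 1 then 1 else 0)"
    using surface_group_hom_integers[of 1 "\<lambda>s. if s = GenB 1 then 1 else 0"] by metis
  have "carrier (surface_group 1) = generate (surface_group 1) {surface_gen 1 (GenA 1), surface_gen 1 (GenB 1)}"
    using generate_surface_gen[of 1] by (simp add: S)
  from group.amenable_left_regular_of_commuting_generators[OF group_surface_group this _ _ torus_group_commute p(1) _ _ q(1)]
  show ?thesis
    using p(2) q(2) surface_gen_closed[of _ 1] by (simp add: S)
qed

section \<open>Grafting a lattice onto the regular action\<close>

text \<open>
  The group acts on the disjoint union of itself and the lattice, on the latter through the translations
  by \<open>(p x, q x)\<close>.  The assumption \<open>twist\<close> is the property of surface groups that the construction uses: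
  the image of the generator \<open>a\<close> can be multiplied by anything that commutes with the image of \<open>b\<close>.
  The generator \<open>c\<close> translates the lattice as \<open>a\<close> does but is not affected by the surgery.
\<close>
lemma ex_grafted_action:
  fixes G (structure) and p q :: "'a \<Rightarrow> int"
  defines "X \<equiv> carrier G <+> (UNIV :: (int \<times> int) set)"
  assumes "group G" and gen: "carrier G = generate G (insert a T)"
    and T: "insert a T \<subseteq> carrier G" "b \<in> T" "c \<in> T"
    and hom: "p \<in> hom G integer_group" "q \<in> hom G integer_group"
    and p: "p a = 1" "p b = 0" "p c = 1" and q: "q a = 0" "q b = 1" "q c = 0"
    and pq: "\<And>t. t \<in> T \<Longrightarrow> t \<noteq> b \<Longrightarrow> t \<noteq> c \<Longrightarrow> p t = 0 \<and> q t = 0"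
    and twist: "\<And>(\<phi> :: 'a \<Rightarrow> 'a + int \<times> int \<Rightarrow> 'a + int \<times> int) \<sigma>.
        \<phi> \<in> hom G (BijGroup X) \<Longrightarrow> \<sigma> \<in> carrier (BijGroup X) \<Longrightarrow>
        \<sigma> \<otimes>\<^bsub>BijGroup X\<^esub> \<phi> b = \<phi> b \<otimes>\<^bsub>BijGroup X\<^esub> \<sigma> \<Longrightarrow>
        \<exists>\<phi>' \<in> hom G (BijGroup X). \<phi>' a = \<phi> a \<otimes>\<^bsub>BijGroup X\<^esub> \<sigma> \<and> (\<forall>t\<in>T. \<phi>' t = \<phi> t)"
  shows "\<exists>\<phi>. transitive_action G X \<phi> \<and> faithful_action G X \<phi> \<and> amenable_action G X \<phi>"
proof -
  interpret group G by fact
  interpret p: group_hom G integer_group p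
    by (intro group_hom.intro group_hom_axioms.intro hom) simp_all
  interpret q: group_hom G integer_group q
    by (intro group_hom.intro group_hom_axioms.intro hom) simp_all
  have abc [simp]: "a \<in> carrier G" "b \<in> carrier G" "c \<in> carrier G" and Tc: "\<And>t. t \<in> T \<Longrightarrow> t \<in> carrier G"
    using T by auto
  have phom [simp]: "p (x \<otimes> y) = p x + p y" "q (x \<otimes> y) = q x + q y"
    if "x \<in> carrier G" "y \<in> carrier G" for x y
    using that by simp_all
  have X_cases: "(\<exists>y\<in>carrier G. z = Inl y) \<or> (\<exists>i j. z = Inr (i, j))" if "z \<in> X" for z
    using that by (auto simp: X_def)
  have X_mem [simp]: "Inl y \<in> X \<longleftrightarrow> y \<in> carrier G" "Inr ij \<in> X" for y ij
    by (auto simp: X_def)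

  \<comment> \<open>The line along which the regular part is cut.\<close>
  define L where "L = range (\<lambda>n::int. b [^] n)"
  have LI [simp]: "b [^] n \<in> L" for n :: int
    by (simp add: L_def)
  have pow_b: "p (b [^] n) = 0" "q (b [^] n) = n" for n :: int
    using hom_integer_pow[OF is_group hom(1), of b n] hom_integer_pow[OF is_group hom(2), of b n] p q by simp_all
  have pL: "p y = 0" if "y \<in> L" for y
    using that by (auto simp: L_def pow_b)
  have b_pow: "b \<otimes> b [^] n = b [^] (1 + n)" for n :: int
    by (simp add: int_pow_mult)
  have bL: "b \<otimes> y \<in> L \<longleftrightarrow> y \<in> L" if "y \<in> carrier G" for y
  proof
    assume "b \<otimes> y \<in> L"
    then obtain n :: int where "b \<otimes> y = b [^] n" by (auto simp: L_def)
    also have "\<dots> = b \<otimes> b [^] (n - 1)" by (simp add: b_pow)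
    finally show "y \<in> L" using that by simp
  next
    assume "y \<in> L"
    then show "b \<otimes> y \<in> L" by (auto simp: L_def b_pow)
  qed

  define act where "act x = (\<lambda>z\<in>X. case z of Inl y \<Rightarrow> Inl (x \<otimes> y) | Inr (i, j) \<Rightarrow> Inr (p x + i, q x + j))" for x
  have act_Inl: "act x (Inl y) = Inl (x \<otimes> y)" if "y \<in> carrier G" for x y
    using that by (simp add: act_def)
  have act_Inr: "act x (Inr (i, j)) = Inr (p x + i, q x + j)" for x i j
    by (simp add: act_def)
  have "group_action G X act"
  proof (rule group_actionI[OF is_group])
    show "act x \<in> extensional X" for x by (simp add: act_def)
    show "act x z \<in> X" if "x \<in> carrier G" "z \<in> X" for x z
      using that X_cases[of z] by (auto simp: act_Inl act_Inr)
    show "act \<one> z = z" if "z \<in> X" for z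
      using that X_cases[of z] p.hom_one q.hom_one by (auto simp: act_Inl act_Inr)
    show "act (x \<otimes> y) z = act x (act y z)" if "x \<in> carrier G" "y \<in> carrier G" "z \<in> X" for x y z
      using that X_cases[of z] by (auto simp: act_Inl act_Inr m_assoc)
  qed
  then interpret act: group_action G X act .
  have act_hom: "act \<in> hom G (BijGroup X)"
    using act.group_hom by (simp add: group_hom_def group_hom_axioms_def)

  \<comment> \<open>The point \<open>b\<^sup>n\<close> of the regular part is exchanged with the lattice point \<open>(0, n)\<close>.
      Since \<open>q (b\<^sup>n) = n\<close>, this is well defined, and it respects the action of \<open>b\<close>.\<close>
  define \<sigma> where "\<sigma> = (\<lambda>z\<in>X. case z of Inl y \<Rightarrow> if y \<in> L then Inr (0, q y) else Inl y
      | Inr (i, j) \<Rightarrow> if i = 0 then Inl (b [^] j) else Inr (i, j))"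
  have \<sigma>_Inl: "\<sigma> (Inl y) = (if y \<in> L then Inr (0, q y) else Inl y)" if "y \<in> carrier G" for y
    using that by (simp add: \<sigma>_def)
  have \<sigma>_Inr: "\<sigma> (Inr (i, j)) = (if i = 0 then Inl (b [^] j) else Inr (i, j))" for i j
    by (simp add: \<sigma>_def)
  have \<sigma>_closed: "\<sigma> z \<in> X" and \<sigma>_\<sigma>: "\<sigma> (\<sigma> z) = z" if "z \<in> X" for z
    using that X_cases[of z] by (auto simp: \<sigma>_Inl \<sigma>_Inr L_def pow_b)
  have \<sigma>: "\<sigma> \<in> carrier (BijGroup X)"
  proof -
    have "bij_betw \<sigma> X X"
      by (rule bij_betw_byWitness[of _ \<sigma>]) (use \<sigma>_closed \<sigma>_\<sigma> in auto)
    then show ?thesis by (simp add: BijGroup_def Bij_def \<sigma>_def)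
  qed
  have "\<sigma> \<otimes>\<^bsub>BijGroup X\<^esub> act b = act b \<otimes>\<^bsub>BijGroup X\<^esub> \<sigma>"
  proof -
    have actb: "act b \<in> carrier (BijGroup X)"
      using act_hom by (auto simp: hom_def)
    have "\<sigma> (act b z) = act b (\<sigma> z)" if "z \<in> X" for z
      using that X_cases[of z] by (auto simp: act_Inl act_Inr \<sigma>_Inl \<sigma>_Inr p q bL b_pow)
    then have "compose X \<sigma> (act b) = compose X (act b) \<sigma>"
      by (auto simp: compose_def)
    then show ?thesis using \<sigma> actb by (simp add: BijGroup_def)
  qed
  from twist[OF act_hom \<sigma> this] obtain \<phi> where \<phi>_hom: "\<phi> \<in> hom G (BijGroup X)"
      and \<phi>a: "\<phi> a = act a \<otimes>\<^bsub>BijGroup X\<^esub> \<sigma>" and \<phi>T: "\<And>t. t \<in> T \<Longrightarrow> \<phi> t = act t" by blast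
  interpret \<phi>: group_action G X \<phi>
    by (intro group_action.intro group_hom.intro group_hom_axioms.intro \<phi>_hom is_group group_BijGroup)
  have \<phi>a_apply: "\<phi> a z = act a (\<sigma> z)" if "z \<in> X" for z
    unfolding \<phi>a by (rule BijGroup_mult_apply) (use act_hom \<sigma> that in \<open>auto simp: hom_def\<close>)
  have \<phi>a_Inl: "\<phi> a (Inl y) = Inl (a \<otimes> y)" if "y \<in> carrier G" "y \<notin> L" for y
    using that by (simp add: \<phi>a_apply \<sigma>_Inl act_Inl)
  have \<phi>a_L: "\<phi> a (Inl (b [^] n)) = Inr (1, n)" for n :: int
    by (simp add: \<phi>a_apply \<sigma>_Inl act_Inr pow_b p q)
  have \<phi>a_Inr: "\<phi> a (Inr (i, j)) = (if i = 0 then Inl (a \<otimes> b [^] j) else Inr (1 + i, j))" for i j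
    by (simp add: \<phi>a_apply \<sigma>_Inr act_Inl act_Inr p q)
  have \<phi>_closed: "\<phi> x z \<in> X" if "x \<in> carrier G" "z \<in> X" for x z
    using \<phi>.element_image[OF that refl] .
  have by_generators: "carrier G \<subseteq> H" if "subgroup H G" "insert a T \<subseteq> H" for H
    using generate_subgroup_incl[OF that(2,1)] gen by simp

  have "amenable_action G X \<phi>"
  proof (rule amenable_action_of_quarter_lattice[OF \<phi>.group_action_axioms gen T(1)])
    \<comment> \<open>Starting at column 1 keeps the quarter lattice clear of the column 0, where \<open>a\<close> was changed.\<close>
    define f :: "nat \<times> nat \<Rightarrow> 'a + int \<times> int" where "f = (\<lambda>(i, j). Inr (1 + int i, int j))"
    show "inj f" by (auto simp: inj_def f_def)
    show "range f \<subseteq> X" by (auto simp: f_def)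
    fix s assume "s \<in> insert a T"
    then consider "s = a" | "s \<in> T" "s = b" | "s \<in> T" "s = c" | "s \<in> T" "s \<noteq> b" "s \<noteq> c" by blast
    then show "(\<forall>i j. \<phi> s (f (i, j)) = f (i, j)) \<or> (\<forall>i j. \<phi> s (f (i, j)) = f (Suc i, j)) \<or>
        (\<forall>i j. \<phi> s (f (i, j)) = f (i, Suc j))"
    proof cases
      case 4
      then show ?thesis using pq[OF 4] by (simp add: f_def \<phi>T act_Inr)
    qed (auto simp: f_def \<phi>a_Inr \<phi>T act_Inr p q)
  qed

  moreover have "faithful_action G X \<phi>"
  proof
    \<comment> \<open>The surgery is visible only on the level \<open>p = 0\<close>, and a group element moves a point by a bounded number of
        levels; therefore it acts as before on all sufficiently high levels.\<close>
    define H where "H = {x \<in> carrier G. \<exists>N. \<forall>y\<in>carrier G. p y > N \<longrightarrow> \<phi> x (Inl y) = Inl (x \<otimes> y)}"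
    have H_I: "x \<in> H" if "x \<in> carrier G"
      "\<And>y. y \<in> carrier G \<Longrightarrow> p y > N \<Longrightarrow> \<phi> x (Inl y) = Inl (x \<otimes> y)" for x N
      unfolding H_def using that by blast
    have "subgroup H G"
    proof
      show "H \<subseteq> carrier G" by (auto simp: H_def)
      show "\<one> \<in> H" by (auto simp: H_def \<phi>.id_eq_one[symmetric])
    next
      fix x y assume "x \<in> H" "y \<in> H"
      then obtain N M where xy: "x \<in> carrier G" "y \<in> carrier G"
        and N: "\<And>z. z \<in> carrier G \<Longrightarrow> p z > N \<Longrightarrow> \<phi> x (Inl z) = Inl (x \<otimes> z)"
        and M: "\<And>z. z \<in> carrier G \<Longrightarrow> p z > M \<Longrightarrow> \<phi> y (Inl z) = Inl (y \<otimes> z)"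
        unfolding H_def by blast
      have "\<phi> (x \<otimes> y) (Inl z) = Inl (x \<otimes> y \<otimes> z)" if "z \<in> carrier G" "p z > max M (N - p y)" for z
        using that xy by (simp add: \<phi>.composition_rule M N m_assoc)
      then show "x \<otimes> y \<in> H" by (intro H_I[of _ "max M (N - p y)"]) (use xy in auto)
    next
      fix x assume "x \<in> H"
      then obtain N where x: "x \<in> carrier G"
        and N: "\<And>z. z \<in> carrier G \<Longrightarrow> p z > N \<Longrightarrow> \<phi> x (Inl z) = Inl (x \<otimes> z)"
        unfolding H_def by blast
      have "\<phi> (inv x) (Inl z) = Inl (inv x \<otimes> z)" if z: "z \<in> carrier G" "p z > N + p x" for z
      proof (rule \<phi>.orbit_sym_aux[OF x])
        have "p (inv x \<otimes> z) > N" using z x p.hom_inv[OF x] by simp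
        then show "\<phi> x (Inl (inv x \<otimes> z)) = Inl z"
          using N[of "inv x \<otimes> z"] x z by (simp flip: m_assoc)
      qed (use x z in auto)
      then show "inv x \<in> H" by (intro H_I[of _ "N + p x"]) (use x in auto)
    qed
    moreover have "insert a T \<subseteq> H"
    proof -
      have "\<phi> a (Inl y) = Inl (a \<otimes> y)" if "y \<in> carrier G" "p y > 0" for y
        using that pL[of y] \<phi>a_Inl[of y] by auto
      then have "a \<in> H" by (intro H_I[of _ 0]) auto
      moreover have "t \<in> H" if "t \<in> T" for t
        using that Tc by (intro H_I[of _ 0]) (auto simp: \<phi>T act_Inl)
      ultimately show ?thesis by blast
    qed
    ultimately have H: "carrier G \<subseteq> H" by (rule by_generators)
    show "inj_on \<phi> (carrier G)"
    proof (rule inj_onI)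
      fix x y assume xy: "x \<in> carrier G" "y \<in> carrier G" "\<phi> x = \<phi> y"
      from xy(1,2) H have "x \<in> H" "y \<in> H" by auto
      then obtain N M where N: "\<And>z. z \<in> carrier G \<Longrightarrow> p z > N \<Longrightarrow> \<phi> x (Inl z) = Inl (x \<otimes> z)"
        and M: "\<And>z. z \<in> carrier G \<Longrightarrow> p z > M \<Longrightarrow> \<phi> y (Inl z) = Inl (y \<otimes> z)"
        unfolding H_def by blast
      \<comment> \<open>A point so high that both \<open>x\<close> and \<open>y\<close> act on it by left multiplication.\<close>
      define z where "z = a [^] (max N M + 1)"
      have z: "z \<in> carrier G" "p z = max N M + 1"
        using hom_integer_pow[OF is_group hom(1), of a "max N M + 1"] p by (simp_all add: z_def)
      then have "x \<otimes> z = y \<otimes> z"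
        using N[of z] M[of z] xy(3) by simp
      then show "x = y" using xy z by simp
    qed
  qed

  moreover have "transitive_action G X \<phi>"
  proof -
    define U where "U = orbit G \<phi> (Inr (0, 0))"
    have U_iff: "\<phi> x z \<in> U \<longleftrightarrow> z \<in> U" if x: "x \<in> carrier G" and z: "z \<in> X" for x z
    proof
      have step: "\<phi> y w \<in> U" if "y \<in> carrier G" "w \<in> U" for y w
      proof -
        obtain v where v: "v \<in> carrier G" "w = \<phi> v (Inr (0, 0))"
          using \<open>w \<in> U\<close> by (auto simp: U_def orbit_def)
        then have "\<phi> y w = \<phi> (y \<otimes> v) (Inr (0, 0))"
          using \<open>y \<in> carrier G\<close> by (simp add: \<phi>.composition_rule)
        then show ?thesis
          using v \<open>y \<in> carrier G\<close> unfolding U_def orbit_def by blast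
      qed
      then show "z \<in> U \<Longrightarrow> \<phi> x z \<in> U" using x by blast
      have "\<phi> (inv x) (\<phi> x z) = z" using \<phi>.orbit_sym_aux[OF x z refl] .
      then show "\<phi> x z \<in> U \<Longrightarrow> z \<in> U" using step[of "inv x" "\<phi> x z"] x by simp
    qed
    have U_c: "Inr (1 + i, j) \<in> U \<longleftrightarrow> Inr (i, j) \<in> U" for i j
      using U_iff[of c "Inr (i, j)"] T by (simp add: \<phi>T act_Inr p q)
    have U_b: "Inr (i, 1 + j) \<in> U \<longleftrightarrow> Inr (i, j) \<in> U" for i j
      using U_iff[of b "Inr (i, j)"] T by (simp add: \<phi>T act_Inr p q)
    have "Inr (0, 0) \<in> U"
      unfolding U_def by (rule \<phi>.orbit_refl) simp
    then have "Inr (i, 0) \<in> U" for i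
      by (induction i rule: int_induct[of _ 0]) (use U_c[of _ 0] U_c[of "_ - 1" 0] in \<open>simp_all add: add.commute\<close>)
    then have U_Inr: "Inr (i, j) \<in> U" for i j
      by (induction j rule: int_induct[of _ 0]) (use U_b[of i] U_b[of i "_ - 1"] in \<open>simp_all add: add.commute\<close>)
    \<comment> \<open>Both ends of every edge that the surgery has cut are now joined to the lattice by \<open>a\<close>.\<close>
    have U_L: "Inl y \<in> U" "Inl (a \<otimes> y) \<in> U" if "y \<in> L" for y
    proof -
      obtain n :: int where y: "y = b [^] n" using \<open>y \<in> L\<close> by (auto simp: L_def)
      show "Inl y \<in> U"
        using U_iff[of a "Inl y"] U_Inr by (simp add: y \<phi>a_L)
      show "Inl (a \<otimes> y) \<in> U"
        using U_iff[of a "Inr (0, n)"] U_Inr by (simp add: y \<phi>a_Inr)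
    qed
    \<comment> \<open>Consequently the trace of the orbit \<open>U\<close> on the regular part is invariant under left multiplication by
        every generator, including \<open>a\<close>.\<close>
    define H where "H = {x \<in> carrier G. \<forall>y\<in>carrier G. Inl (x \<otimes> y) \<in> U \<longleftrightarrow> Inl y \<in> U}"
    have "subgroup H G"
    proof
      show "H \<subseteq> carrier G" "\<one> \<in> H" by (auto simp: H_def)
      show "x \<otimes> y \<in> H" if "x \<in> H" "y \<in> H" for x y
        using that by (auto simp: H_def m_assoc)
      show "inv x \<in> H" if "x \<in> H" for x
      proof -
        have x: "x \<in> carrier G" using that by (simp add: H_def)
        have "Inl (inv x \<otimes> y) \<in> U \<longleftrightarrow> Inl y \<in> U" if y: "y \<in> carrier G" for y
        proof -
          have "Inl (x \<otimes> (inv x \<otimes> y)) \<in> U \<longleftrightarrow> Inl (inv x \<otimes> y) \<in> U"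
            using \<open>x \<in> H\<close> x y by (simp add: H_def)
          then show ?thesis using x y by (simp flip: m_assoc)
        qed
        then show ?thesis using x by (simp add: H_def)
      qed
    qed
    moreover have "insert a T \<subseteq> H"
    proof -
      have "Inl (a \<otimes> y) \<in> U \<longleftrightarrow> Inl y \<in> U" if y: "y \<in> carrier G" for y
        using U_iff[of a "Inl y"] U_L[of y] \<phi>a_Inl[of y] y by (cases "y \<in> L") auto
      moreover have "Inl (t \<otimes> y) \<in> U \<longleftrightarrow> Inl y \<in> U" if "t \<in> T" "y \<in> carrier G" for t y
        using U_iff[of t "Inl y"] that Tc by (simp add: \<phi>T act_Inl)
      ultimately show ?thesis using Tc by (auto simp: H_def)
    qed
    ultimately have H: "carrier G \<subseteq> H" by (rule by_generators)
    have U_Inl: "Inl x \<in> U" if "x \<in> carrier G" for x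
    proof -
      have "x \<in> H" using H that by auto
      then have "Inl (x \<otimes> \<one>) \<in> U \<longleftrightarrow> Inl \<one> \<in> U"
        using one_closed unfolding H_def by blast
      moreover have "\<one> \<in> L" using LI[of 0] by simp
      ultimately show ?thesis using U_L(1)[of \<one>] that by simp
    qed
    have X_U: "z \<in> U" if "z \<in> X" for z
      using X_cases[OF that] U_Inl U_Inr by auto
    show ?thesis
    proof
      fix z w assume zw: "z \<in> X" "w \<in> X"
      then obtain x y where x: "x \<in> carrier G" "\<phi> x (Inr (0, 0)) = z" and y: "y \<in> carrier G" "\<phi> y (Inr (0, 0)) = w"
        using X_U[of z] X_U[of w] by (auto simp: U_def orbit_def)
      have "\<phi> (y \<otimes> inv x) z = w"
        using \<phi>.composition_rule[of z y "inv x"] \<phi>.orbit_sym_aux[OF x(1) _ x(2)] zw x(1) y by simp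
      then show "\<exists>x\<in>carrier G. \<phi> x z = w" using x y by blast
    qed
  qed
  ultimately show ?thesis by blast
qed

section \<open>Surface groups act amenably\<close>

lemma ex_action_higher_genus:
  assumes "g \<ge> 2"
  shows "\<exists>\<phi>. transitive_action (surface_group g) (carrier (surface_group g) <+> (UNIV :: (int \<times> int) set)) \<phi> \<and>
    faithful_action (surface_group g) (carrier (surface_group g) <+> UNIV) \<phi> \<and>
    amenable_action (surface_group g) (carrier (surface_group g) <+> UNIV) \<phi>"
proof -
  let ?S = "surface_generators g" and ?s = "surface_gen g"
  have S: "GenA 1 \<in> ?S" "GenA 2 \<in> ?S" "GenB 1 \<in> ?S"
    using assms by (auto simp: surface_generators_def)
  obtain p where p: "p \<in> hom (surface_group g) integer_group"
      "\<And>s. s \<in> ?S \<Longrightarrow> p (?s s) = (if s \<in> {GenA 1, GenA 2} then 1 else 0)"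
    using surface_group_hom_integers[of g "\<lambda>s. if s \<in> {GenA 1, GenA 2} then 1 else 0"] by metis
  obtain q where q: "q \<in> hom (surface_group g) integer_group"
      "\<And>s. s \<in> ?S \<Longrightarrow> q (?s s) = (if s = GenB 1 then 1 else 0)"
    using surface_group_hom_integers[of g "\<lambda>s. if s = GenB 1 then 1 else 0"] by metis
  let ?H = "BijGroup (carrier (surface_group g) <+> (UNIV :: (int \<times> int) set))"
  show ?thesis
  proof (rule ex_grafted_action[where a = "?s (GenA 1)" and b = "?s (GenB 1)" and c = "?s (GenA 2)"
        and T = "?s ` (?S - {GenA 1})" and p = p and q = q])
    show "group (surface_group g)" by (rule group_surface_group)
    have S_insert: "insert (?s (GenA 1)) (?s ` (?S - {GenA 1})) = ?s ` ?S"
      using S by blast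
    show "carrier (surface_group g) = generate (surface_group g) (insert (?s (GenA 1)) (?s ` (?S - {GenA 1})))"
      unfolding S_insert by (rule generate_surface_gen)
    show "insert (?s (GenA 1)) (?s ` (?S - {GenA 1})) \<subseteq> carrier (surface_group g)"
      unfolding S_insert by (intro image_subsetI surface_gen_closed)
    show "?s (GenB 1) \<in> ?s ` (?S - {GenA 1})" "?s (GenA 2) \<in> ?s ` (?S - {GenA 1})"
      using S by auto
    show "p t = 0 \<and> q t = 0" if "t \<in> ?s ` (?S - {GenA 1})" "t \<noteq> ?s (GenB 1)" "t \<noteq> ?s (GenA 2)" for t
      using that p(2) q(2) by auto
    show "\<exists>\<phi>'\<in>hom (surface_group g) ?H. \<phi>' (?s (GenA 1)) = \<phi> (?s (GenA 1)) \<otimes>\<^bsub>?H\<^esub> \<sigma> \<and>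
        (\<forall>t\<in>?s ` (?S - {GenA 1}). \<phi>' t = \<phi> t)"
      if H: "\<phi> \<in> hom (surface_group g) ?H" "\<sigma> \<in> carrier ?H"
        "\<sigma> \<otimes>\<^bsub>?H\<^esub> \<phi> (?s (GenB 1)) = \<phi> (?s (GenB 1)) \<otimes>\<^bsub>?H\<^esub> \<sigma>" for \<phi> \<sigma>
    proof -
      have "group ?H" by (simp add: group_BijGroup)
      obtain \<phi>' where "\<phi>' \<in> hom (surface_group g) ?H" "\<phi>' (?s (GenA 1)) = \<phi> (?s (GenA 1)) \<otimes>\<^bsub>?H\<^esub> \<sigma>"
          "\<And>s. s \<in> ?S \<Longrightarrow> s \<noteq> GenA 1 \<Longrightarrow> \<phi>' (?s s) = \<phi> (?s s)"
        using surface_group_hom_twist[OF \<open>group ?H\<close> H(1) _ H(2,3)] assms by auto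
      then show ?thesis by auto
    qed
  qed (use S p q in auto)
qed

theorem theorem21:
  fixes g :: nat
  assumes "g \<ge> 1"
  shows "\<exists>(X :: nat set) \<phi>.
           transitive_action (surface_group g) X \<phi> \<and>
           faithful_action (surface_group g) X \<phi> \<and>
           amenable_action (surface_group g) X \<phi>"
proof (cases "g = 1")
  case True
  interpret group "surface_group 1" by (rule group_surface_group)
  show ?thesis
    unfolding True
    by (rule ex_action_on_nat_set[OF countable_surface_group
          transitive_left_regular faithful_left_regular torus_left_regular_amenable])
next
  case False
  then obtain \<phi> where
    "transitive_action (surface_group g) (carrier (surface_group g) <+> (UNIV :: (int \<times> int) set)) \<phi>"
    "faithful_action (surface_group g) (carrier (surface_group g) <+> (UNIV :: (int \<times> int) set)) \<phi>"
    "amenable_action (surface_group g) (carrier (surface_group g) <+> (UNIV :: (int \<times> int) set)) \<phi>"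
    using ex_action_higher_genus[of g] assms by force
  moreover have "countable (carrier (surface_group g) <+> (UNIV :: (int \<times> int) set))"
    by (intro countable_Plus countable_surface_group countableI_type)
  ultimately show ?thesis by (intro ex_action_on_nat_set)
qed

end
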